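(* Let $n$ be a positive integer, let $\mathbf c$ be a family $(c_k)_{k\in N}$ of non-negative integers indexed by $N=\{1,\dots,n\}$ together with a linear order $\prec$ on $N$ lifting the natural order on $\{c_k\}_{k\in N}$. Let $K(\mathbf c)\subset\mathbb Q^n$ be the convex set, $E(K(\mathbf c))$ its set of extremal points, and $Z(\mathbf c)$ the set of functions of the canonical $S$-graph $\mathscr G(\mathbf c)$ (viewed as a subset of $\mathbb Q^n$), all as defined in the context. Then $$E(K(\mathbf c))=Z(\mathbf c).$$
   Context: Notation. $N=\{1,\dots,n\}$, $\hat N=\{1,\dots,n+1\}$; $<$ is the usual order on $N$. $\mathbf c$ denotes a family $(c_k)_{k\in N}$ of non-negative integers together with a linear (total) order $\prec$ on $N$ such that $i\prec j$ implies $c_i\le c_j$. The set $K(\mathbf c)$. Write $N=\{s_1,\dots,s_n\}$ with $s_1\prec s_2\prec\cdots\prec s_n$. For each $k\in N$ put $N_k=\{s_1,\dots,s_k\}$ and write $N_k=\{t_1,\dots,t_k\}$ with $t_1<t_2<\cdots<t_k$ (the $t_i$ depend on $k$). $K(\mathbf c)$ is the set of $(c'_k)_{k\in N}\in\mathbb Q^n$ such that $0\le c'_k\le c_k$ for all $k\in N$ and, for every $k\in N$ and every $i\in\{1,\dots,k-1\}$, $$c'_{t_{i+1}}-c'_{t_i}\ \ge\ \min\{0,\,c_{t_{i+1}}-c_{t_i}\}.$$ $E(K(\mathbf c))$ is the set of extremal (extreme) points of $K(\mathbf c)$, over the base field $\mathbb Q$. The graph $\mathscr G(\mathbf c)$ (binary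 fusion). $\mathscr G(\mathbf c)$ is a finite graph with vertices labelled by elements of $\hat N$ and edges labelled by elements of $N$ (the edge label $i$ carries the value $c_i$), with a distinguished vertex $v_0$. It is defined recursively. For $n=0$ it is a single vertex, with label $1$, which is $v_0$. For $n\ge1$, let $s=s_n$ be the $\prec$-maximal element of $N$ and let $\mathbf c^-$ be the family $(c_k)_{k\in N\setminus\{s\}}$ with the induced order, where the index set $N\setminus\{s\}$ is identified with $\{1,\dots,n-1\}$ by the increasing bijection. Let $\mathscr G^+$ be the graph $\mathscr G(\mathbf c^-)$ with vertex labels in $[s,n]$ increased by $1$ and edge labels in $[s,n-1]$ increased by $1$, the other labels being unchanged (so vertex labels of $\mathscr G^+$ lie in $\hat N\setminus\{s\}$, edge labels in $N\setminus\{s\}$). Let $\mathscr G^-$ be a disjoint copy of $\mathscr G^+$, with isomorphism of unlabelled graphs $\varphi:\mathscr G^+\to\mathscr G^-$ preserving all vertex and edge labels except that if $v$ has label $s+1$ then $\varphi(v)$ has label $s$. Then $\mathscr G(\mathbf c)$ is the union of $\mathscr G^+$ and $\mathscr G^-$ together with, for each vertex $v$ of $\mathscr G^+$ with label $s+1$, an additional edge with label $s$ joining $v$ to $\varphi(v)$. The distinguished vertex of $\mathscr G(\mathbf c)$ is the vertex of $\mathscr G^+$ corresponding to the distinguished vertex of $\mathscr G(\mathbf c^-)$; it has label $n+1$. The set $Z(\mathbf c)$. Let $r^1,\dots,r^{n+1}$ be linearly independent linear functions on an $(n+1)$-dimensional $\mathbb Q$-vector space. It is known that there is a unique family of linear functions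 $(z_v)$, $v$ a vertex of $\mathscr G(\mathbf c)$, with $z_{v_0}=0$ and $z_v-z_{v'}=c_r(r^k-r^\ell)$ whenever $v$ (with label $k$) and $v'$ (with label $\ell$) are joined by an edge with label $r$. Put $Z(\mathbf c)=\{z_v : v\in V(\mathscr G(\mathbf c))\}$. Each $z_v$ is of the form $\sum_{i\in N}c'_i(r^i-r^{i+1})$ and is identified with $(c'_i)_{i\in N}\in\mathbb Q^n$. *)

theory Defs
  imports Complex_Main "HOL-Library.Function_Algebras"
begin

section \<open>Scalar multiplication of rational functions and extreme points over the rationals\<close>

definition fscale :: "rat \<Rightarrow> ('a \<Rightarrow> rat) \<Rightarrow> 'a \<Rightarrow> rat" where
  "fscale a f = (\<lambda>x. a * f x)"

text \<open>Rational \<open>n\<close>-space, with coordinates indexed by \<open>{1..n}\<close>; vectors are continued by \<open>0\<close> outside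
  the index set, so that it is a linear subspace of the space of all functions.\<close>

definition rat_space :: "nat \<Rightarrow> (nat \<Rightarrow> rat) set" where
  "rat_space n = {x. \<forall>i. i \<notin> {1..n} \<longrightarrow> x i = 0}"

text \<open>The library's \<open>extreme_point_of\<close> is restricted to real vector spaces; this is the same
  definition with rational scalars.\<close>

definition rat_extreme_points :: "('a \<Rightarrow> rat) set \<Rightarrow> ('a \<Rightarrow> rat) set" where
  "rat_extreme_points S = {x \<in> S. \<forall>a\<in>S. \<forall>b\<in>S.
     \<not> (a \<noteq> b \<and> (\<exists>t. 0 < t \<and> t < 1 \<and> x = fscale (1 - t) a + fscale t b))}"

section \<open>The convex set\<close>

text \<open>The linear order on \<open>{1..n}\<close> is given by its strict part \<open>prec\<close>, a set of pairs.
  The list below is \<open>[s\<^sub>1, \<dots>, s\<^sub>n]\<close> with \<open>s\<^sub>1 \<prec> \<dots> \<prec> s\<^sub>n\<close>.\<close>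

definition prec_list :: "nat \<Rightarrow> (nat \<times> nat) set \<Rightarrow> nat list" where
  "prec_list n prec = (THE s. set s = {1..n} \<and> sorted_wrt (\<lambda>i j. (i, j) \<in> prec) s)"

text \<open>Lists are indexed from \<open>0\<close>: with \<open>t\<close> the increasing enumeration of \<open>{s\<^sub>1, \<dots>, s\<^sub>k}\<close>,
  \<open>t ! (i - 1)\<close> is \<open>t\<^sub>i\<close> and \<open>t ! i\<close> is its successor.\<close>

definition K_set :: "nat \<Rightarrow> (nat \<times> nat) set \<Rightarrow> (nat \<Rightarrow> nat) \<Rightarrow> (nat \<Rightarrow> rat) set" where
  "K_set n prec c = {x \<in> rat_space n.
     (\<forall>k\<in>{1..n}. 0 \<le> x k \<and> x k \<le> of_nat (c k)) \<and>
     (\<forall>k\<in>{1..n}. \<forall>i\<in>{1..k - 1}.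
        let t = sorted_list_of_set (set (take k (prec_list n prec))) in
          x (t ! i) - x (t ! (i - 1)) \<ge> min 0 (of_nat (c (t ! i)) - of_nat (c (t ! (i - 1)))))}"

section \<open>The graph obtained by binary fusion\<close>

text \<open>An edge is a pair of its set of end points and its label.\<close>

record 'v labelled_graph =
  verts :: "'v set"
  edges :: "('v set \<times> nat) set"
  label :: "'v \<Rightarrow> nat"
  base :: 'v

text \<open>The increasing bijection from \<open>{1..m}\<close> to \<open>{1..Suc m} - {s}\<close>. On labels it is the
  increment by \<open>1\<close> of those that are at least \<open>s\<close>.\<close>

definition skip :: "nat \<Rightarrow> nat \<Rightarrow> nat" where
  "skip s i = (if i < s then i else i + 1)"

definition shift_labels :: "nat \<Rightarrow> 'v labelled_graph \<Rightarrow> 'v labelled_graph" where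
  "shift_labels s G = \<lparr>verts = verts G, edges = {(e, skip s r) | e r. (e, r) \<in> edges G},
     label = (\<lambda>v. skip s (label G v)), base = base G\<rparr>"

text \<open>The disjoint copies of the graph are realised by prefixing vertices, which are lists of
  booleans: \<open>True # v\<close> is the vertex \<open>v\<close> of the plus copy \<open>G\<close>, and \<open>False # v\<close> is its image in
  the minus copy.\<close>

definition binary_fusion :: "nat \<Rightarrow> bool list labelled_graph \<Rightarrow> bool list labelled_graph" where
  "binary_fusion s G = \<lparr>
     verts = (#) True ` verts G \<union> (#) False ` verts G,
     edges = {((#) b ` e, r) | b e r. (e, r) \<in> edges G} \<union>
             {({True # v, False # v}, s) | v. v \<in> verts G \<and> label G v = s + 1},
     label = (\<lambda>w. if hd w then label G (tl w)
                  else if label G (tl w) = s + 1 then s else label G (tl w)),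
     base = True # base G\<rparr>"

text \<open>The labelled graph depends only on the order; the values \<open>c\<close> enter through the edge
  labels when the functions \<open>z\<close> are defined. The inverse image is the order induced on the
  complement of the maximal element, transported to \<open>{1..m}\<close>.\<close>

fun fusion_graph :: "nat \<Rightarrow> (nat \<times> nat) set \<Rightarrow> bool list labelled_graph" where
  "fusion_graph 0 prec = \<lparr>verts = {[]}, edges = {}, label = (\<lambda>_. 1), base = []\<rparr>"
| "fusion_graph (Suc m) prec =
     (let s = last (prec_list (Suc m) prec)
      in binary_fusion s (shift_labels s (fusion_graph m (inv_image prec (skip s)))))"

section \<open>The functions attached to the vertices\<close>

text \<open>Outside the vertex set the family is fixed to be \<open>undefined\<close>, for the sake of
  uniqueness.\<close>

definition z_family ::
  "(rat \<Rightarrow> 'v::ab_group_add \<Rightarrow> 'v) \<Rightarrow> (nat \<Rightarrow> 'v \<Rightarrow> rat) \<Rightarrow> nat \<Rightarrow> (nat \<times> nat) set \<Rightarrow> (nat \<Rightarrow> nat)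
    \<Rightarrow> bool list \<Rightarrow> 'v \<Rightarrow> rat" where
  "z_family scale r n prec c = (let G = fusion_graph n prec in
     (THE z. (\<forall>v. v \<notin> verts G \<longrightarrow> z v = undefined) \<and>
        (\<forall>v\<in>verts G. Vector_Spaces.linear scale (*) (z v)) \<and>
        z (base G) = 0 \<and>
        (\<forall>v\<in>verts G. \<forall>w\<in>verts G. \<forall>e. ({v, w}, e) \<in> edges G \<longrightarrow>
           z v - z w = fscale (of_nat (c e)) (r (label G v) - r (label G w)))))"

definition Z_functions ::
  "(rat \<Rightarrow> 'v::ab_group_add \<Rightarrow> 'v) \<Rightarrow> (nat \<Rightarrow> 'v \<Rightarrow> rat) \<Rightarrow> nat \<Rightarrow> (nat \<times> nat) set \<Rightarrow> (nat \<Rightarrow> nat)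
    \<Rightarrow> ('v \<Rightarrow> rat) set" where
  "Z_functions scale r n prec c = z_family scale r n prec c ` verts (fusion_graph n prec)"

definition fun_of_coords :: "(nat \<Rightarrow> 'v \<Rightarrow> rat) \<Rightarrow> nat \<Rightarrow> (nat \<Rightarrow> rat) \<Rightarrow> 'v \<Rightarrow> rat" where
  "fun_of_coords r n x = (\<Sum>i\<in>{1..n}. fscale (x i) (r i - r (i + 1)))"

text \<open>The identification with a subset of rational \<open>n\<close>-space. The map \<open>fun_of_coords r n\<close> is
  injective on \<open>rat_space n\<close> whenever \<open>r 1, \<dots>, r (n + 1)\<close> are linearly independent, and all the
  functions in question are in its range.\<close>

definition Z_set ::
  "(rat \<Rightarrow> 'v::ab_group_add \<Rightarrow> 'v) \<Rightarrow> (nat \<Rightarrow> 'v \<Rightarrow> rat) \<Rightarrow> nat \<Rightarrow> (nat \<times> nat) set \<Rightarrow> (nat \<Rightarrow> nat)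
    \<Rightarrow> (nat \<Rightarrow> rat) set" where
  "Z_set scale r n prec c =
     inv_into (rat_space n) (fun_of_coords r n) ` Z_functions scale r n prec c"

end

theory Submission
  imports Defs
begin

text \<open>
  The convex set and the graph are built by the same recursion, which removes the index \<open>s\<close> that
  is maximal for \<open>\<prec>\<close>; the proof compares the two recursions.

  \<^bold>\<open>The convex set.\<close> Let \<open>y\<close> be the point obtained from \<open>x\<close> by dropping the coordinate \<open>x\<^sub>s\<close>, and
  let \<open>l\<close> and \<open>u\<close> be the neighbours \<open>s - 1\<close> and \<open>s + 1\<close> of \<open>s\<close>. As \<open>c\<^sub>s\<close> is the largest of all
  the \<open>c\<^sub>i\<close>, the gap conditions of the last stage that involve \<open>s\<close> read \<open>x\<^sub>l \<le> x\<^sub>s\<close> and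
  \<open>x\<^sub>s \<le> x\<^sub>u + c\<^sub>s - c\<^sub>u\<close>. As \<open>x\<^sub>l \<ge> 0\<close> and \<open>x\<^sub>u \<le> c\<^sub>u\<close>, they imply
  \<open>0 \<le> x\<^sub>s \<le> c\<^sub>s\<close>; and when a neighbour is missing, the convention that \<open>x\<close> and \<open>c\<close> vanish at \<open>0\<close>
  and at \<open>n + 1\<close> turns its inequality into one of these two bounds.
  The gap conditions of the last stage away from \<open>s\<close> are already among those for \<open>y\<close>. So the
  convex set is the region between the graphs of two affine functions
  \<open>y \<mapsto> y\<^sub>l\<close> and \<open>y \<mapsto> y\<^sub>u + c\<^sub>s - c\<^sub>u\<close> over the convex set in one dimension less
  (\<open>K_set_Suc\<close>). The extreme points of such a region are the points of the two graphs over the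
  extreme points of the base (\<open>rat_extreme_points_between_graphs\<close>).

  \<^bold>\<open>The graph.\<close> The same two functions describe binary fusion: the coordinate \<open>s\<close> is the lower
  value on the plus copy and the upper value on the minus copy. The recursive function
  \<open>vertex_coords\<close> is defined in this way, so that the extreme points are its values on the vertices
  (\<open>rat_extreme_points_K_set\<close>). What remains is that \<open>vertex_coords\<close> solves the defining equations
  of the family \<open>z\<close>. In coordinates \<open>r\<^sup>k - r\<^sup>l\<close> is a difference of indicator functions of half-lines,
  which behaves well under insertion of a coordinate; this takes care of the edges inside a copy.
  For the edges that join the copies one needs an invariant: at a vertex with label \<open>k\<close> the
  coordinate \<open>k - 1\<close> is \<open>0\<close> and the coordinate \<open>k\<close> is \<open>c\<^sub>k\<close> (\<open>vertex_coords_at_label\<close>). At the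
  ends of such an edge the lower value is then \<open>0\<close> and the upper value is \<open>c\<^sub>s\<close>.

  The solution is unique because the graph is connected (\<open>fusion_graph_connected\<close>), and coordinates
  are determined by the linear function because the \<open>r\<^sup>i\<close> are linearly independent
  (\<open>inj_on_fun_of_coords\<close>).
\<close>

section \<open>Linear orders as lists\<close>

lemma ex_sorted_wrt_list:
  assumes "finite A" and "trans r" and "irrefl r" and "total_on A r"
  shows "\<exists>xs. set xs = A \<and> sorted_wrt (\<lambda>i j. (i, j) \<in> r) xs"
  using assms(1,4)
proof (induction A rule: finite_remove_induct)
  case empty
  show ?case by simp
next
  case (remove A)
  have "asymp_on A (\<lambda>x y. (x, y) \<in> r)" "transp_on A (\<lambda>x y. (x, y) \<in> r)"
    using assms(2,3) by (auto intro: transp_onI dest: transD simp: irrefl_def)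
  then have "\<exists>m\<in>A. \<forall>x\<in>A. x \<noteq> m \<longrightarrow> (m, x) \<notin> r"
    using Finite_Set.bex_max_element[of A "\<lambda>x y. (x, y) \<in> r"] remove.hyps(1,2) by blast
  then obtain m where m: "m \<in> A" "\<And>x. x \<in> A \<Longrightarrow> x \<noteq> m \<Longrightarrow> (x, m) \<in> r"
    using remove.prems unfolding total_on_def by blast
  have "total_on (A - {m}) r"
    using remove.prems by (auto simp: total_on_def)
  then obtain xs where "set xs = A - {m}" "sorted_wrt (\<lambda>i j. (i, j) \<in> r) xs"
    using remove.IH[OF m(1)] by blast
  with m have "set (xs @ [m]) = A \<and> sorted_wrt (\<lambda>i j. (i, j) \<in> r) (xs @ [m])"
    by (auto simp: sorted_wrt_append)
  then show ?case by blast
qed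

lemma sorted_wrt_irrefl_distinct:
  assumes "irrefl r" and "sorted_wrt (\<lambda>i j. (i, j) \<in> r) xs"
  shows "distinct xs"
  using assms(2) by (induction xs) (use assms(1) in \<open>auto simp: irrefl_def\<close>)

lemma sorted_wrt_list_unique:
  assumes "trans r" and "irrefl r" and "set xs = set ys"
    and "sorted_wrt (\<lambda>i j. (i, j) \<in> r) xs" and "sorted_wrt (\<lambda>i j. (i, j) \<in> r) ys"
  shows "xs = ys"
  using assms(3-5)
proof (induction xs arbitrary: ys)
  case Nil
  then show ?case by simp
next
  case (Cons x xs)
  then obtain y ys' where ys: "ys = y # ys'"
    by (cases ys) auto
  have asym: "\<not> ((a, b) \<in> r \<and> (b, a) \<in> r)" for a b
    using assms(1,2) by (meson irrefl_def transD)
  have dist: "distinct (x # xs)" "distinct (y # ys')"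
    using sorted_wrt_irrefl_distinct assms(2) Cons.prems ys by blast+
  have "x = y"
  proof (rule ccontr)
    assume "x \<noteq> y"
    then have "x \<in> set ys'" "y \<in> set xs"
      using Cons.prems(1) ys by auto
    then show False
      using Cons.prems(2,3) ys asym by auto
  qed
  moreover from this have "set xs = set ys'"
    using Cons.prems(1) ys dist by auto
  ultimately show ?case
    using Cons.IH[of ys'] Cons.prems ys by auto
qed

lemma prec_list_unique:
  assumes "strict_linear_order_on {1..n} prec"
    and "set xs = {1..n}" and "sorted_wrt (\<lambda>i j. (i, j) \<in> prec) xs"
  shows "prec_list n prec = xs"
  unfolding prec_list_def
proof (rule the_equality)
  show "set xs = {1..n} \<and> sorted_wrt (\<lambda>i j. (i, j) \<in> prec) xs"
    using assms(2,3) by blast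
  show "ys = xs" if "set ys = {1..n} \<and> sorted_wrt (\<lambda>i j. (i, j) \<in> prec) ys" for ys
    using assms that sorted_wrt_list_unique[of prec ys xs]
    unfolding strict_linear_order_on_def by metis
qed

lemma
  assumes "strict_linear_order_on {1..n} prec"
  shows set_prec_list: "set (prec_list n prec) = {1..n}"
    and sorted_wrt_prec_list: "sorted_wrt (\<lambda>i j. (i, j) \<in> prec) (prec_list n prec)"
    and distinct_prec_list: "distinct (prec_list n prec)"
    and length_prec_list: "length (prec_list n prec) = n"
proof -
  obtain xs where xs: "set xs = {1..n}" "sorted_wrt (\<lambda>i j. (i, j) \<in> prec) xs"
    using ex_sorted_wrt_list[of "{1..n}" prec] assms
    by (auto simp: strict_linear_order_on_def)
  then have eq: "prec_list n prec = xs"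
    using prec_list_unique assms by blast
  show "set (prec_list n prec) = {1..n}"
    and "sorted_wrt (\<lambda>i j. (i, j) \<in> prec) (prec_list n prec)"
    using xs eq by simp_all
  show d: "distinct (prec_list n prec)"
    using xs(2) eq assms sorted_wrt_irrefl_distinct
    by (auto simp: strict_linear_order_on_def)
  show "length (prec_list n prec) = n"
    using distinct_card[OF d] xs(1) eq by simp
qed

section \<open>Removing the maximal index\<close>

lemma skip_inject [simp]: "skip s i = skip s j \<longleftrightarrow> i = j"
  by (auto simp: skip_def)

lemma skip_less_iff [simp]: "skip s i < skip s j \<longleftrightarrow> i < j"
  by (auto simp: skip_def)

lemma skip_image:
  assumes "s \<in> {1..Suc m}"
  shows "skip s ` {1..m} = {1..Suc m} - {s}"
proof
  show "skip s ` {1..m} \<subseteq> {1..Suc m} - {s}"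
    using assms by (auto simp: skip_def split: if_splits)
  show "{1..Suc m} - {s} \<subseteq> skip s ` {1..m}"
  proof
    fix j assume j: "j \<in> {1..Suc m} - {s}"
    then have "j = skip s (if j < s then j else j - 1)"
      by (auto simp: skip_def)
    moreover have "(if j < s then j else j - 1) \<in> {1..m}"
      using j assms by auto
    ultimately show "j \<in> skip s ` {1..m}"
      by blast
  qed
qed

lemma strict_linear_order_on_inv_image_skip:
  assumes "strict_linear_order_on {1..Suc m} prec" and "s \<in> {1..Suc m}"
  shows "strict_linear_order_on {1..m} (inv_image prec (skip s))"
proof -
  have "skip s i \<in> {1..Suc m}" if "i \<in> {1..m}" for i
    using skip_image[OF assms(2)] that by blast
  then show ?thesis
    using assms(1) unfolding strict_linear_order_on_def total_on_def
    by (auto simp: irrefl_def trans_inv_image simp del: atLeastAtMost_iff)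
qed

text \<open>The recursion that the convex set and the graph share: all prefixes of the list but the last
  one belong to the order induced on the complement of \<open>s\<close>.\<close>

lemma prec_list_Suc:
  fixes m prec
  assumes ord: "strict_linear_order_on {1..Suc m} prec"
  defines "s \<equiv> last (prec_list (Suc m) prec)"
  shows last_prec_list_in: "s \<in> {1..Suc m}"
    and last_prec_list_greatest: "\<And>i. i \<in> {1..Suc m} \<Longrightarrow> i \<noteq> s \<Longrightarrow> (i, s) \<in> prec"
    and prec_list_Suc_eq:
      "prec_list (Suc m) prec = map (skip s) (prec_list m (inv_image prec (skip s))) @ [s]"
proof -
  define xs where "xs = butlast (prec_list (Suc m) prec)"
  have eq: "prec_list (Suc m) prec = xs @ [s]"
    unfolding xs_def s_def using length_prec_list[OF ord] by (metis append_butlast_last_id list.size(3) nat.distinct(1))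
  show s: "s \<in> {1..Suc m}"
    using set_prec_list[OF ord] eq by auto
  show max: "(i, s) \<in> prec" if "i \<in> {1..Suc m}" "i \<noteq> s" for i
    using that sorted_wrt_prec_list[OF ord] set_prec_list[OF ord] unfolding eq
    by (auto simp: sorted_wrt_append simp del: atLeastAtMost_iff)
  let ?prec = "inv_image prec (skip s)"
  note ord' = strict_linear_order_on_inv_image_skip[OF ord s]
  show "prec_list (Suc m) prec = map (skip s) (prec_list m ?prec) @ [s]"
  proof (rule prec_list_unique[OF ord])
    have "skip s ` set (prec_list m ?prec) = {1..Suc m} - {s}"
      using set_prec_list[OF ord'] skip_image[OF s] by simp
    then show "set (map (skip s) (prec_list m ?prec) @ [s]) = {1..Suc m}"
      using s by auto
    have "(skip s x, s) \<in> prec" if "x \<in> set (prec_list m ?prec)" for x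
      using max[of "skip s x"] that set_prec_list[OF ord'] skip_image[OF s] by blast
    with sorted_wrt_prec_list[OF ord']
    show "sorted_wrt (\<lambda>i j. (i, j) \<in> prec) (map (skip s) (prec_list m ?prec) @ [s])"
      by (auto simp: sorted_wrt_append sorted_wrt_map)
  qed
qed

lemma last_prec_list_max:
  fixes c :: "nat \<Rightarrow> nat"
  assumes "strict_linear_order_on {1..Suc m} prec"
    and "\<And>i j. (i, j) \<in> prec \<Longrightarrow> c i \<le> c j" and "i \<in> {1..Suc m}"
  shows "c i \<le> c (last (prec_list (Suc m) prec))"
  using last_prec_list_greatest[OF assms(1,3)] assms(2)
  by (cases "i = last (prec_list (Suc m) prec)") auto

section \<open>Inserting a coordinate\<close>

definition insert_coord :: "nat \<Rightarrow> rat \<Rightarrow> (nat \<Rightarrow> rat) \<Rightarrow> nat \<Rightarrow> rat" where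
  "insert_coord s t y = (\<lambda>j. if j = s then t else if j < s then y j else y (j - 1))"

lemma insert_coord_same [simp]: "insert_coord s t y s = t"
  by (simp add: insert_coord_def)

lemma insert_coord_skip [simp]: "insert_coord s t y (skip s i) = y i"
  by (simp add: insert_coord_def skip_def)

lemma insert_coord_comp_skip [simp]: "insert_coord s t y \<circ> skip s = y"
  by (simp add: fun_eq_iff)

lemma insert_coord_eq_self: "insert_coord s (x s) (x \<circ> skip s) = x"
  by (auto simp: insert_coord_def skip_def fun_eq_iff)

lemma insert_coord_inject [simp]:
  "insert_coord s t y = insert_coord s t' y' \<longleftrightarrow> t = t' \<and> y = y'"
  by (metis insert_coord_comp_skip insert_coord_same)

lemma insert_coord_in_rat_space:
  assumes "s \<in> {1..Suc m}"
  shows "insert_coord s t y \<in> rat_space (Suc m) \<longleftrightarrow> y \<in> rat_space m"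
proof
  assume y: "y \<in> rat_space m"
  show "insert_coord s t y \<in> rat_space (Suc m)"
    unfolding rat_space_def
  proof (intro CollectI allI impI)
    fix i assume i: "i \<notin> {1..Suc m}"
    have "i = 0 \<or> i > s \<and> i - 1 \<notin> {1..m}"
      using i assms by auto
    then show "insert_coord s t y i = 0"
      using y assms unfolding rat_space_def insert_coord_def by auto
  qed
next
  assume x: "insert_coord s t y \<in> rat_space (Suc m)"
  have "y i = 0" if "i \<notin> {1..m}" for i
  proof -
    have "skip s i \<notin> {1..Suc m}"
      using that assms by (auto simp: skip_def)
    then show ?thesis
      using x unfolding rat_space_def by (metis (mono_tags, lifting) insert_coord_skip mem_Collect_eq)
  qed
  then show "y \<in> rat_space m"
    by (simp add: rat_space_def)
qed

lemma insert_coord_convex_comb: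
  "insert_coord s ((1 - u) * a + u * b) (fscale (1 - u) x + fscale u y)
    = fscale (1 - u) (insert_coord s a x) + fscale u (insert_coord s b y)"
  by (auto simp: insert_coord_def fscale_def fun_eq_iff)

text \<open>A point strictly between the graphs is inside a vertical segment, and a segment in the base
  lifts to a segment in either graph, by affinity. Conversely, a segment through a graph point over
  an extreme point is vertical, and it cannot leave the region on the side of that graph.\<close>

lemma rat_extreme_points_between_graphs:
  fixes L U :: "(nat \<Rightarrow> rat) \<Rightarrow> rat"
  assumes le: "\<And>y. y \<in> S \<Longrightarrow> L y \<le> U y"
    and L: "\<And>u a b. L (fscale (1 - u) a + fscale u b) = (1 - u) * L a + u * L b"
    and U: "\<And>u a b. U (fscale (1 - u) a + fscale u b) = (1 - u) * U a + u * U b"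
  shows "rat_extreme_points {insert_coord s t y | t y. y \<in> S \<and> L y \<le> t \<and> t \<le> U y}
    = (\<lambda>y. insert_coord s (L y) y) ` rat_extreme_points S
      \<union> (\<lambda>y. insert_coord s (U y) y) ` rat_extreme_points S"
    (is "rat_extreme_points ?R = ?G L \<union> ?G U")
proof
  have lift: "y \<in> rat_extreme_points S"
    if ext: "insert_coord s (H y) y \<in> rat_extreme_points ?R" and H: "H = L \<or> H = U"
    for H y
  proof -
    have "y \<in> S"
      using ext by (auto simp: rat_extreme_points_def)
    moreover have "a = b" if "a \<in> S" "b \<in> S" "0 < u" "u < 1"
      "y = fscale (1 - u) a + fscale u b" for a b u
    proof -
      have "H y = (1 - u) * H a + u * H b"
        using H L U that(5) by metis
      then have "insert_coord s (H y) y
          = fscale (1 - u) (insert_coord s (H a) a) + fscale u (insert_coord s (H b) b)"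
        using that(5) insert_coord_convex_comb by metis
      moreover have "insert_coord s (H a) a \<in> ?R" "insert_coord s (H b) b \<in> ?R"
        using H le that(1,2) by auto
      ultimately have "insert_coord s (H a) a = insert_coord s (H b) b"
        using ext that(3,4) unfolding rat_extreme_points_def by blast
      then show ?thesis by simp
    qed
    ultimately show ?thesis
      unfolding rat_extreme_points_def by blast
  qed
  show "rat_extreme_points ?R \<subseteq> ?G L \<union> ?G U"
  proof
    fix x assume x: "x \<in> rat_extreme_points ?R"
    then obtain t y where ty: "x = insert_coord s t y" "y \<in> S" "L y \<le> t" "t \<le> U y"
      by (auto simp: rat_extreme_points_def)
    have "t = L y \<or> t = U y"
    proof (rule ccontr)
      assume "\<not> (t = L y \<or> t = U y)"
      with ty have lt: "L y < t" "t < U y" by auto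
      define u where "u = (t - L y) / (U y - L y)"
      have u: "0 < u" "u < 1"
        using lt by (auto simp: u_def)
      have "u * (U y - L y) = t - L y"
        using lt by (simp add: u_def)
      then have "t = (1 - u) * L y + u * U y"
        by (simp add: algebra_simps)
      moreover have "y = fscale (1 - u) y + fscale u y"
        by (simp add: fscale_def fun_eq_iff algebra_simps)
      ultimately have "x = fscale (1 - u) (insert_coord s (L y) y)
          + fscale u (insert_coord s (U y) y)"
        using ty(1) insert_coord_convex_comb by metis
      moreover have "insert_coord s (L y) y \<in> ?R" "insert_coord s (U y) y \<in> ?R"
        using le ty(2) by auto
      ultimately have "insert_coord s (L y) y = insert_coord s (U y) y"
        using x u unfolding rat_extreme_points_def by blast
      with lt show False by simp
    qed
    then show "x \<in> ?G L \<union> ?G U"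
      using lift x ty(1) by blast
  qed
  have extreme: "insert_coord s (H y) y \<in> rat_extreme_points ?R"
    if y: "y \<in> rat_extreme_points S" and H: "H = L \<or> H = U" for H y
  proof -
    have "insert_coord s (H y) y \<in> ?R"
      using y H le by (auto simp: rat_extreme_points_def)
    moreover have "a = b"
      if ab: "a \<in> ?R" "b \<in> ?R" and u: "0 < u" "u < 1"
        and eq: "insert_coord s (H y) y = fscale (1 - u) a + fscale u b" for a b u
    proof -
      obtain \<alpha> a' where a: "a = insert_coord s \<alpha> a'" "a' \<in> S" "L a' \<le> \<alpha>" "\<alpha> \<le> U a'"
        using ab by auto
      obtain \<beta> b' where b: "b = insert_coord s \<beta> b'" "b' \<in> S" "L b' \<le> \<beta>" "\<beta> \<le> U b'"
        using ab by auto
      have "insert_coord s (H y) y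
          = insert_coord s ((1 - u) * \<alpha> + u * \<beta>) (fscale (1 - u) a' + fscale u b')"
        using eq a(1) b(1) insert_coord_convex_comb by metis
      then have comb: "H y = (1 - u) * \<alpha> + u * \<beta>" "y = fscale (1 - u) a' + fscale u b'"
        unfolding insert_coord_inject by blast+
      then have "a' = b'"
        using y a(2) b(2) u unfolding rat_extreme_points_def by blast
      moreover from this have "y = a'"
        using comb(2) by (simp add: fscale_def fun_eq_iff algebra_simps)
      ultimately have bounds: "L y \<le> \<alpha>" "\<alpha> \<le> U y" "L y \<le> \<beta>" "\<beta> \<le> U y"
        using a b by auto
      \<comment> \<open>Both summands have the same sign, as \<open>H y\<close> is an end point of the fibre.\<close>
      have zero: "(1 - u) * (\<alpha> - H y) + u * (\<beta> - H y) = 0"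
        using comb(1) by (simp add: algebra_simps)
      have "\<alpha> - H y = 0 \<and> \<beta> - H y = 0"
      proof (cases "H = L")
        case True
        then have "0 \<le> (1 - u) * (\<alpha> - H y)" "0 \<le> u * (\<beta> - H y)"
          using bounds u by simp_all
        then have "(1 - u) * (\<alpha> - H y) = 0" "u * (\<beta> - H y) = 0"
          using zero by linarith+
        then show ?thesis using u by simp
      next
        case False
        then have "(1 - u) * (\<alpha> - H y) \<le> 0" "u * (\<beta> - H y) \<le> 0"
          using bounds u H by (simp_all add: mult_le_0_iff)
        then have "(1 - u) * (\<alpha> - H y) = 0" "u * (\<beta> - H y) = 0"
          using zero by linarith+
        then show ?thesis using u by simp
      qed
      then show "a = b"
        using a(1) b(1) \<open>a' = b'\<close> by simp
    qed
    ultimately show ?thesis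
      unfolding rat_extreme_points_def by blast
  qed
  show "?G L \<union> ?G U \<subseteq> rat_extreme_points ?R"
    using extreme by blast
qed

section \<open>The convex set as an iterated region between graphs\<close>

text \<open>The second family of inequalities in the definition of the convex set, for a single stage with
  index set \<open>A\<close>. Stages are compared through their index sets below, which is why \<open>A\<close> replaces
  the prefix of the ordered list.\<close>

definition gap_condition :: "(nat \<Rightarrow> rat) \<Rightarrow> (nat \<Rightarrow> nat) \<Rightarrow> nat set \<Rightarrow> bool" where
  "gap_condition x c A \<longleftrightarrow> (let t = sorted_list_of_set A in \<forall>i\<in>{1..card A - 1}.
     x (t ! i) - x (t ! (i - 1)) \<ge> min 0 (of_nat (c (t ! i)) - of_nat (c (t ! (i - 1)))))"

lemma sorted_list_of_set_skip_image:
  assumes "finite A"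
  shows "sorted_list_of_set (skip s ` A) = map (skip s) (sorted_list_of_set A)"
proof -
  have "sorted_wrt (<) (map (skip s) (sorted_list_of_set A))"
    by (simp add: sorted_wrt_map)
  then show ?thesis
    using sorted_list_of_set_unique[of "skip s ` A" "map (skip s) (sorted_list_of_set A)"] assms
    by (simp add: card_image inj_on_def)
qed

lemma gap_condition_skip_image:
  assumes "finite A"
  shows "gap_condition x c (skip s ` A) \<longleftrightarrow> gap_condition (x \<circ> skip s) (c \<circ> skip s) A"
proof -
  have "card (skip s ` A) = card A"
    by (simp add: card_image inj_on_def)
  moreover have "map (skip s) (sorted_list_of_set A) ! i = skip s (sorted_list_of_set A ! i)"
    "map (skip s) (sorted_list_of_set A) ! (i - 1) = skip s (sorted_list_of_set A ! (i - 1))"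
    if "i \<in> {1..card A - 1}" for i
    using that by auto
  ultimately show ?thesis
    unfolding gap_condition_def Let_def sorted_list_of_set_skip_image[OF assms] by simp
qed

lemma gap_condition_atLeastAtMost:
  "gap_condition x c {1..n} \<longleftrightarrow>
    (\<forall>i\<in>{1..n - 1}. x (Suc i) - x i \<ge> min 0 (of_nat (c (Suc i)) - of_nat (c i)))"
proof -
  have "sorted_list_of_set {1..n} = [1..<Suc n]"
    using sorted_list_of_set_range[of 1 "Suc n"] by (simp only: atLeastLessThanSuc_atLeastAtMost)
  moreover have "[1..<Suc n] ! i = Suc i \<and> [1..<Suc n] ! (i - 1) = i" if "i \<in> {1..n - 1}" for i
    using that by (auto simp del: upt_Suc)
  ultimately show ?thesis
    unfolding gap_condition_def Let_def by simp
qed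

lemma K_set_eq_gap_conditions:
  assumes "strict_linear_order_on {1..n} prec"
  shows "K_set n prec c = {x \<in> rat_space n. (\<forall>k\<in>{1..n}. 0 \<le> x k \<and> x k \<le> of_nat (c k)) \<and>
    (\<forall>k\<in>{1..n}. gap_condition x c (set (take k (prec_list n prec))))}"
proof -
  have "card (set (take k (prec_list n prec))) = k" if "k \<in> {1..n}" for k
    using that distinct_prec_list[OF assms] length_prec_list[OF assms]
    by (simp add: distinct_card)
  then show ?thesis
    unfolding K_set_def gap_condition_def Let_def by auto
qed

lemma K_set_gap:
  assumes "strict_linear_order_on {1..n} prec" and "x \<in> K_set n prec c" and "1 \<le> i" and "i < n"
  shows "x (Suc i) - x i \<ge> min 0 (of_nat (c (Suc i)) - of_nat (c i))"
proof -
  have "set (take n (prec_list n prec)) = {1..n}"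
    using set_prec_list[OF assms(1)] length_prec_list[OF assms(1)] by simp
  moreover have "n \<in> {1..n}"
    using assms(3,4) by simp
  ultimately have "gap_condition x c {1..n}"
    using assms(2) unfolding K_set_eq_gap_conditions[OF assms(1)] by (metis (lifting) CollectD)
  then show ?thesis
    unfolding gap_condition_atLeastAtMost using assms(3,4) by simp
qed

text \<open>Extension by \<open>0\<close> makes the extreme cases \<open>s = 1\<close> and \<open>s = n\<close>, in which \<open>s\<close> has no left or no
  right neighbour, instances of the general formulas.\<close>

definition zero_ext :: "nat \<Rightarrow> (nat \<Rightarrow> nat) \<Rightarrow> nat \<Rightarrow> rat" where
  "zero_ext n c i = (if i \<in> {1..n} then of_nat (c i) else 0)"

lemma zero_ext_skip:
  assumes "s \<in> {1..Suc m}"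
  shows "zero_ext (Suc m) c (skip s i) = zero_ext m (c \<circ> skip s) i"
  using assms by (auto simp: zero_ext_def skip_def)

text \<open>The bounds on the coordinate \<open>s\<close> in terms of the point \<open>y\<close> that has it removed. In \<open>y\<close> the left
  neighbour of \<open>s\<close> has index \<open>s - 1\<close>, but the right neighbour has index \<open>s\<close> rather than \<open>s + 1\<close>.\<close>

definition fibre_lower :: "nat \<Rightarrow> (nat \<Rightarrow> rat) \<Rightarrow> rat" where
  "fibre_lower s y = y (s - 1)"

definition fibre_upper :: "nat \<Rightarrow> nat \<Rightarrow> (nat \<Rightarrow> nat) \<Rightarrow> (nat \<Rightarrow> rat) \<Rightarrow> rat" where
  "fibre_upper m s c y = y s + of_nat (c s) - zero_ext m (c \<circ> skip s) s"

lemma K_set_0: "K_set 0 prec c = {\<lambda>_. 0}"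
  by (auto simp: K_set_def rat_space_def)

lemma K_set_rat_space: "x \<in> K_set n prec c \<Longrightarrow> x \<in> rat_space n"
  by (simp add: K_set_def)

lemma K_set_bounds:
  assumes "x \<in> K_set n prec c"
  shows "0 \<le> x i" and "x i \<le> zero_ext n c i"
  using assms by (cases "i \<in> {1..n}"; auto simp: K_set_def rat_space_def zero_ext_def)+

lemma zero_ext_skip_le_max:
  assumes "\<And>i. i \<in> {1..Suc m} \<Longrightarrow> c i \<le> c s" and "s \<in> {1..Suc m}"
  shows "zero_ext m (c \<circ> skip s) i \<le> of_nat (c s)"
proof (cases "i \<in> {1..m}")
  case True
  then have "skip s i \<in> {1..Suc m}"
    using skip_image[OF assms(2)] by blast
  then show ?thesis
    using assms(1) True by (simp add: zero_ext_def)
qed (auto simp: zero_ext_def)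

text \<open>Once \<open>s\<close> is removed, its two neighbours are adjacent, and their gap condition is what is
  needed; at the ends of the range a bound on a single coordinate takes its place.\<close>

lemma fibre_lower_le_upper:
  assumes ord: "strict_linear_order_on {1..m} prec" and s: "s \<in> {1..Suc m}"
    and max: "\<And>i. i \<in> {1..Suc m} \<Longrightarrow> c i \<le> c s"
    and y: "y \<in> K_set m prec (c \<circ> skip s)"
  shows "fibre_lower s y \<le> fibre_upper m s c y"
proof (cases "1 < s \<and> s \<le> m")
  case True
  then have "y s - y (s - 1) \<ge> min 0 (of_nat ((c \<circ> skip s) s) - of_nat ((c \<circ> skip s) (s - 1)))"
    using K_set_gap[OF ord y, of "s - 1"] by fastforce
  moreover have "zero_ext m (c \<circ> skip s) s = of_nat ((c \<circ> skip s) s)"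
    "zero_ext m (c \<circ> skip s) (s - 1) = of_nat ((c \<circ> skip s) (s - 1))"
    using True by (auto simp: zero_ext_def)
  moreover have "zero_ext m (c \<circ> skip s) s \<le> of_nat (c s)"
    "zero_ext m (c \<circ> skip s) (s - 1) \<le> of_nat (c s)"
    using zero_ext_skip_le_max[where c = c and s = s, OF max s] by blast+
  ultimately show ?thesis
    unfolding fibre_lower_def fibre_upper_def by linarith
next
  case False
  have ends: "y s = 0 \<and> zero_ext m (c \<circ> skip s) s = 0" if "s = Suc m"
    using K_set_rat_space[OF y] that by (simp add: rat_space_def zero_ext_def)
  have start: "y (s - 1) = 0" if "s = 1"
    using K_set_rat_space[OF y] that by (simp add: rat_space_def)
  have "zero_ext m (c \<circ> skip s) (s - 1) \<le> of_nat (c s)" "zero_ext m (c \<circ> skip s) s \<le> of_nat (c s)"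
    using zero_ext_skip_le_max[where c = c and s = s, OF max s] by blast+
  moreover have "0 \<le> y s" "y (s - 1) \<le> zero_ext m (c \<circ> skip s) (s - 1)"
    using K_set_bounds[OF y] by blast+
  moreover have "s = 1 \<or> s = Suc m"
    using False s by auto
  ultimately show ?thesis
    using ends start unfolding fibre_lower_def fibre_upper_def by auto
qed

text \<open>Only the last stage mentions \<open>s\<close>. Since \<open>c s\<close> is maximal, the minimum in its gap condition with
  the left neighbour is \<open>0\<close>, and the one with the right neighbour is the difference of the \<open>c\<close>.\<close>

lemma K_set_Suc:
  fixes m prec c
  assumes ord: "strict_linear_order_on {1..Suc m} prec"
    and mono: "\<And>i j. (i, j) \<in> prec \<Longrightarrow> c i \<le> c j"
  defines "s \<equiv> last (prec_list (Suc m) prec)"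
  shows "K_set (Suc m) prec c = {insert_coord s t y | t y.
    y \<in> K_set m (inv_image prec (skip s)) (c \<circ> skip s) \<and>
    fibre_lower s y \<le> t \<and> t \<le> fibre_upper m s c y}" (is "_ = ?R")
proof -
  let ?prec = "inv_image prec (skip s)"
  let ?K = "K_set m ?prec (c \<circ> skip s)"
  have s: "s \<in> {1..Suc m}"
    unfolding s_def by (rule last_prec_list_in[OF ord])
  have max: "c i \<le> c s" if "i \<in> {1..Suc m}" for i
    unfolding s_def using last_prec_list_max[OF ord mono that] .
  note ord' = strict_linear_order_on_inv_image_skip[OF ord s]
  have take_eq: "set (take k (prec_list (Suc m) prec))
      = (if k = Suc m then {1..Suc m} else skip s ` set (take k (prec_list m ?prec)))"
    if "k \<in> {1..Suc m}" for k
  proof (cases "k = Suc m")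
    case True
    then show ?thesis
      using set_prec_list[OF ord] length_prec_list[OF ord] by simp
  next
    case False
    then show ?thesis
      using that length_prec_list[OF ord'] prec_list_Suc_eq[OF ord, folded s_def]
      by (simp add: take_map)
  qed
  have all_Suc: "(\<forall>k\<in>{1..Suc m}. P k) \<longleftrightarrow> P s \<and> (\<forall>k\<in>{1..m}. P (skip s k))" for P
  proof -
    have "{1..Suc m} = insert s (skip s ` {1..m})"
      using skip_image[OF s] s by auto
    then show ?thesis by simp
  qed
  have all_Suc': "(\<forall>k\<in>{1..Suc m}. P k) \<longleftrightarrow> P (Suc m) \<and> (\<forall>k\<in>{1..m}. P k)" for P
    by (simp add: atLeastAtMostSuc_conv)
  \<comment> \<open>The range is split off at \<open>s\<close> for the bounds on the coordinates, and at \<open>Suc m\<close> for the stages.\<close>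
  have iff: "x \<in> K_set (Suc m) prec c \<longleftrightarrow>
      y \<in> ?K \<and> fibre_lower s y \<le> t \<and> t \<le> fibre_upper m s c y"
    if x: "x = insert_coord s t y" for x t y
  proof -
    let ?gaps = "\<forall>i\<in>{1..m}. x (Suc i) - x i \<ge> min 0 (of_nat (c (Suc i)) - of_nat (c i))"
    have xs: "x s = t" and xskip: "x (skip s i) = y i" and xcomp: "x \<circ> skip s = y" for i
      using x by simp_all
    have gaps: "(\<forall>k\<in>{1..Suc m}. gap_condition x c (set (take k (prec_list (Suc m) prec)))) \<longleftrightarrow>
        ?gaps \<and> (\<forall>k\<in>{1..m}. gap_condition y (c \<circ> skip s) (set (take k (prec_list m ?prec))))"
      unfolding all_Suc' using take_eq
      by (simp add: gap_condition_skip_image xcomp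
          gap_condition_atLeastAtMost[of _ _ "Suc m", simplified])
    have bounds: "(\<forall>k\<in>{1..Suc m}. 0 \<le> x k \<and> x k \<le> of_nat (c k)) \<longleftrightarrow>
        0 \<le> t \<and> t \<le> of_nat (c s) \<and> (\<forall>k\<in>{1..m}. 0 \<le> y k \<and> y k \<le> of_nat ((c \<circ> skip s) k))"
      using all_Suc[of "\<lambda>k. 0 \<le> x k \<and> x k \<le> of_nat (c k)"] xs xskip by simp
    have "x \<in> K_set (Suc m) prec c \<longleftrightarrow> y \<in> rat_space m \<and>
        (0 \<le> t \<and> t \<le> of_nat (c s) \<and> (\<forall>k\<in>{1..m}. 0 \<le> y k \<and> y k \<le> of_nat ((c \<circ> skip s) k))) \<and>
        ?gaps \<and> (\<forall>k\<in>{1..m}. gap_condition y (c \<circ> skip s) (set (take k (prec_list m ?prec))))"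
      unfolding K_set_eq_gap_conditions[OF ord] mem_Collect_eq gaps bounds
      using insert_coord_in_rat_space[OF s, of t y] x by simp
    then have step: "x \<in> K_set (Suc m) prec c \<longleftrightarrow> y \<in> ?K \<and> 0 \<le> t \<and> t \<le> of_nat (c s) \<and> ?gaps"
      unfolding K_set_eq_gap_conditions[OF ord'] by auto
    have "0 \<le> t \<and> t \<le> of_nat (c s) \<and> ?gaps \<longleftrightarrow>
        fibre_lower s y \<le> t \<and> t \<le> fibre_upper m s c y" if y: "y \<in> ?K"
    proof -
      have left: "y (s - 1) = (if s = 1 then 0 else x (s - 1))"
        using K_set_rat_space[OF y] x s by (auto simp: rat_space_def insert_coord_def)
      have right: "y s = (if s = Suc m then 0 else x (Suc s))"
        using K_set_rat_space[OF y] x s by (auto simp: rat_space_def insert_coord_def)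
      have cright: "zero_ext m (c \<circ> skip s) s = (if s = Suc m then 0 else of_nat (c (Suc s)))"
        using s by (auto simp: zero_ext_def skip_def)
      have nonneg: "0 \<le> y (s - 1)" and le: "y s \<le> zero_ext m (c \<circ> skip s) s"
        using K_set_bounds[OF y] by blast+
      \<comment> \<open>Adjacent indices other than \<open>s\<close> are still adjacent after the removal of \<open>s\<close>.\<close>
      have other: "x (Suc i) - x i \<ge> min 0 (of_nat (c (Suc i)) - of_nat (c i))"
        if i: "i \<in> {1..m}" "i \<noteq> s" "Suc i \<noteq> s" for i
      proof -
        define j where "j = (if i < s then i else i - 1)"
        have "i = skip s j" "Suc i = skip s (Suc j)" "1 \<le> j" "j < m"
          using i s by (auto simp: j_def skip_def)
        then show ?thesis
          using K_set_gap[OF ord' y, of j] xskip by simp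
      qed
      have pre: "x s - x (s - 1) \<ge> min 0 (of_nat (c s) - of_nat (c (s - 1))) \<longleftrightarrow> x (s - 1) \<le> t"
        if "s \<noteq> 1"
      proof -
        have "s - 1 \<in> {1..Suc m}"
          using s that by auto
        from max[OF this] show ?thesis
          using xs by (simp add: min_def)
      qed
      have post: "x (Suc s) - x s \<ge> min 0 (of_nat (c (Suc s)) - of_nat (c s)) \<longleftrightarrow>
          t \<le> x (Suc s) + of_nat (c s) - of_nat (c (Suc s))" if "s \<noteq> Suc m"
      proof -
        have "Suc s \<in> {1..Suc m}"
          using s that by auto
        from max[OF this] show ?thesis
          using xs by (auto simp add: min_def)
      qed
      have "?gaps \<longleftrightarrow> (s \<noteq> 1 \<longrightarrow> x (s - 1) \<le> t) \<and>
          (s \<noteq> Suc m \<longrightarrow> t \<le> x (Suc s) + of_nat (c s) - of_nat (c (Suc s)))"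
      proof
        assume gaps: ?gaps
        have "x (s - 1) \<le> t" if "s \<noteq> 1"
        proof -
          have "s - 1 \<in> {1..m}" "Suc (s - 1) = s"
            using s that by auto
          with gaps[rule_format, of "s - 1"] show ?thesis
            using pre[OF that] by simp
        qed
        moreover have "t \<le> x (Suc s) + of_nat (c s) - of_nat (c (Suc s))" if "s \<noteq> Suc m"
          using gaps[rule_format, of s] post[OF that] that s by simp
        ultimately show "(s \<noteq> 1 \<longrightarrow> x (s - 1) \<le> t) \<and>
            (s \<noteq> Suc m \<longrightarrow> t \<le> x (Suc s) + of_nat (c s) - of_nat (c (Suc s)))"
          by blast
      next
        assume near: "(s \<noteq> 1 \<longrightarrow> x (s - 1) \<le> t) \<and>
          (s \<noteq> Suc m \<longrightarrow> t \<le> x (Suc s) + of_nat (c s) - of_nat (c (Suc s)))"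
        show ?gaps
        proof
          fix i assume i: "i \<in> {1..m}"
          consider "i = s" | "Suc i = s" | "i \<noteq> s" "Suc i \<noteq> s" by blast
          then show "x (Suc i) - x i \<ge> min 0 (of_nat (c (Suc i)) - of_nat (c i))"
          proof cases
            case 1
            then show ?thesis using near post i by simp
          next
            case 2
            then have "s \<noteq> 1" "i = s - 1" using i by auto
            then show ?thesis using near pre 2 by simp
          next
            case 3
            then show ?thesis using other i by blast
          qed
        qed
      qed
      then show ?thesis
        using left right cright nonneg le unfolding fibre_lower_def fibre_upper_def
        by (auto split: if_splits)
    qed
    then show ?thesis
      using step by blast
  qed
  show ?thesis
  proof (intro set_eqI iffI)
    fix x assume "x \<in> K_set (Suc m) prec c"
    moreover have "x = insert_coord s (x s) (x \<circ> skip s)"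
      by (rule insert_coord_eq_self[symmetric])
    ultimately show "x \<in> ?R"
      using iff by blast
  next
    fix x assume "x \<in> ?R"
    then show "x \<in> K_set (Suc m) prec c"
      using iff by blast
  qed
qed

lemma rat_extreme_points_K_set_Suc:
  fixes m prec c
  assumes ord: "strict_linear_order_on {1..Suc m} prec"
    and mono: "\<And>i j. (i, j) \<in> prec \<Longrightarrow> c i \<le> c j"
  defines "s \<equiv> last (prec_list (Suc m) prec)"
  defines "E \<equiv> rat_extreme_points (K_set m (inv_image prec (skip s)) (c \<circ> skip s))"
  shows "rat_extreme_points (K_set (Suc m) prec c)
    = (\<lambda>y. insert_coord s (fibre_lower s y) y) ` E
      \<union> (\<lambda>y. insert_coord s (fibre_upper m s c y) y) ` E"
proof -
  have s: "s \<in> {1..Suc m}"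
    unfolding s_def by (rule last_prec_list_in[OF ord])
  have max: "c i \<le> c s" if "i \<in> {1..Suc m}" for i
    unfolding s_def using last_prec_list_max[OF ord mono that] .
  have K: "K_set (Suc m) prec c = {insert_coord s t y | t y.
      y \<in> K_set m (inv_image prec (skip s)) (c \<circ> skip s) \<and>
      fibre_lower s y \<le> t \<and> t \<le> fibre_upper m s c y}"
    unfolding s_def by (rule K_set_Suc[OF ord]) (rule mono)
  show ?thesis
    unfolding K E_def
  proof (rule rat_extreme_points_between_graphs[where L = "fibre_lower s" and U = "fibre_upper m s c"])
    show "fibre_lower s y \<le> fibre_upper m s c y"
      if "y \<in> K_set m (inv_image prec (skip s)) (c \<circ> skip s)" for y
      using fibre_lower_le_upper[OF strict_linear_order_on_inv_image_skip[OF ord s] s max that] .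
  qed (simp_all add: fibre_lower_def fibre_upper_def fscale_def algebra_simps)
qed


section \<open>Coordinates of the vertex functions\<close>

text \<open>One step of the recursion for the graph, with the relabelling included. On the minus copy the
  change of \<open>s + 1\<close> into \<open>s\<close> turns the relabelling \<open>skip s\<close> into \<open>skip (Suc s)\<close>: this copy leaves out
  the label \<open>s + 1\<close> instead of \<open>s\<close>.\<close>

definition fuse :: "nat \<Rightarrow> bool list labelled_graph \<Rightarrow> bool list labelled_graph" where
  "fuse s G = binary_fusion s (shift_labels s G)"

lemma fusion_graph_Suc:
  "fusion_graph (Suc m) prec = (let s = last (prec_list (Suc m) prec)
    in fuse s (fusion_graph m (inv_image prec (skip s))))"
  by (simp add: fuse_def)

lemma skip_eq_Suc_iff: "skip s k = Suc s \<longleftrightarrow> k = s"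
  by (auto simp: skip_def)

lemma verts_fuse: "verts (fuse s G) = (#) True ` verts G \<union> (#) False ` verts G"
  by (simp add: fuse_def binary_fusion_def shift_labels_def)

lemma Cons_in_verts_fuse [simp]: "b # v \<in> verts (fuse s G) \<longleftrightarrow> v \<in> verts G"
  by (cases b) (auto simp: verts_fuse)

lemma base_fuse [simp]: "base (fuse s G) = True # base G"
  by (simp add: fuse_def binary_fusion_def shift_labels_def)

lemma label_fuse [simp]:
  "label (fuse s G) (b # v) = (if b then skip s (label G v) else skip (Suc s) (label G v))"
  by (auto simp: fuse_def binary_fusion_def shift_labels_def skip_def)

lemma edges_fuse:
  "edges (fuse s G) = {((#) b ` e, skip s r) | b e r. (e, r) \<in> edges G} \<union>
    {({True # v, False # v}, s) | v. v \<in> verts G \<and> label G v = s}"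
  by (fastforce simp: fuse_def binary_fusion_def shift_labels_def skip_eq_Suc_iff)

lemma edge_fuse_cases:
  assumes "({v, w}, e) \<in> edges (fuse s G)"
  obtains (copy) b v' w' e' where "v = b # v'" "w = b # w'" "e = skip s e'"
      "({v', w'}, e') \<in> edges G"
    | (rung) u where "u \<in> verts G" "label G u = s" "e = s" "v = True # u" "w = False # u"
    | (rung') u where "u \<in> verts G" "label G u = s" "e = s" "v = False # u" "w = True # u"
proof -
  consider (c) b e0 e' where "{v, w} = (#) b ` e0" "e = skip s e'" "(e0, e') \<in> edges G"
    | (r) u where "u \<in> verts G" "label G u = s" "e = s" "{v, w} = {True # u, False # u}"
    using assms unfolding edges_fuse by blast
  then show thesis
  proof cases
    case c
    then have "v \<in> (#) b ` e0" "w \<in> (#) b ` e0"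
      by blast+
    then obtain v' w' where vw: "v = b # v'" "w = b # w'" by blast
    then have "(#) b ` e0 = (#) b ` {v', w'}"
      using c(1) by simp
    moreover have "inj ((#) b)"
      by (simp add: inj_def)
    ultimately have "e0 = {v', w'}"
      by (simp add: inj_image_eq_iff del: image_insert image_empty)
    then show thesis
      using copy vw c(2,3) by blast
  next
    case r
    then show thesis
      using rung rung' by (auto simp: doubleton_eq_iff)
  qed
qed

lemma copy_edge_fuse:
  assumes "({v, w}, e) \<in> edges G"
  shows "({b # v, b # w}, skip s e) \<in> edges (fuse s G)"
proof -
  have "{b # v, b # w} = (#) b ` {v, w}"
    by simp
  then show ?thesis
    unfolding edges_fuse using assms by blast
qed

lemma rung_edge_fuse:
  assumes "v \<in> verts G" and "label G v = s"
  shows "({True # v, False # v}, s) \<in> edges (fuse s G)"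
  unfolding edges_fuse using assms by blast

text \<open>The coordinates of the function attached to a vertex. The head of a vertex tells the copy in
  which it lies, hence the end of the fibre.\<close>

fun vertex_coords :: "nat \<Rightarrow> (nat \<times> nat) set \<Rightarrow> (nat \<Rightarrow> nat) \<Rightarrow> bool list \<Rightarrow> nat \<Rightarrow> rat" where
  "vertex_coords 0 prec c v = (\<lambda>_. 0)"
| "vertex_coords (Suc m) prec c v =
    (let s = last (prec_list (Suc m) prec);
         y = vertex_coords m (inv_image prec (skip s)) (c \<circ> skip s) (tl v)
     in insert_coord s (if hd v then fibre_lower s y else fibre_upper m s c y) y)"

lemma rat_extreme_points_singleton: "rat_extreme_points {x} = {x}"
  by (auto simp: rat_extreme_points_def)

proposition rat_extreme_points_K_set:
  assumes "strict_linear_order_on {1..n} prec" and "\<And>i j. (i, j) \<in> prec \<Longrightarrow> c i \<le> c j"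
  shows "rat_extreme_points (K_set n prec c) = vertex_coords n prec c ` verts (fusion_graph n prec)"
  using assms
proof (induction n arbitrary: prec c)
  case 0
  then show ?case
    by (simp add: K_set_0 rat_extreme_points_singleton)
next
  case (Suc m)
  define s where "s = last (prec_list (Suc m) prec)"
  have s: "s \<in> {1..Suc m}"
    unfolding s_def by (rule last_prec_list_in[OF Suc.prems(1)])
  let ?prec = "inv_image prec (skip s)"
  let ?x = "vertex_coords m ?prec (c \<circ> skip s)"
  have IH: "rat_extreme_points (K_set m ?prec (c \<circ> skip s)) = ?x ` verts (fusion_graph m ?prec)"
    by (rule Suc.IH[OF strict_linear_order_on_inv_image_skip[OF Suc.prems(1) s]])
      (use Suc.prems(2) in simp)
  have "rat_extreme_points (K_set (Suc m) prec c)
      = (\<lambda>y. insert_coord s (fibre_lower s y) y) ` ?x ` verts (fusion_graph m ?prec)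
        \<union> (\<lambda>y. insert_coord s (fibre_upper m s c y) y) ` ?x ` verts (fusion_graph m ?prec)"
    unfolding IH[symmetric] unfolding s_def
    by (rule rat_extreme_points_K_set_Suc[OF Suc.prems(1)]) (rule Suc.prems(2))
  also have "\<dots> = vertex_coords (Suc m) prec c ` verts (fusion_graph (Suc m) prec)"
    unfolding fusion_graph_Suc Let_def s_def[symmetric] verts_fuse image_Un image_image
    by (simp add: Let_def s_def[symmetric])
  finally show ?case .
qed

lemma vertex_coords_in_rat_space:
  assumes "strict_linear_order_on {1..n} prec"
  shows "vertex_coords n prec c v \<in> rat_space n"
  using assms
proof (induction n arbitrary: prec c v)
  case 0
  then show ?case by (simp add: rat_space_def)
next
  case (Suc m)
  have s: "last (prec_list (Suc m) prec) \<in> {1..Suc m}"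
    by (rule last_prec_list_in[OF Suc.prems])
  then show ?case
    using Suc.IH[OF strict_linear_order_on_inv_image_skip[OF Suc.prems s]]
    by (simp add: Let_def insert_coord_in_rat_space del: atLeastAtMost_iff)
qed

lemma vertex_coords_base:
  assumes "strict_linear_order_on {1..n} prec"
  shows "vertex_coords n prec c (base (fusion_graph n prec)) = 0"
  using assms
proof (induction n arbitrary: prec c)
  case 0
  then show ?case by (simp add: zero_fun_def)
next
  case (Suc m)
  have s: "last (prec_list (Suc m) prec) \<in> {1..Suc m}"
    by (rule last_prec_list_in[OF Suc.prems])
  show ?case
    using Suc.IH[OF strict_linear_order_on_inv_image_skip[OF Suc.prems s]]
    by (simp add: fusion_graph_Suc Let_def fibre_lower_def insert_coord_def fun_eq_iff
        del: fusion_graph.simps)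
qed

lemma label_image_fusion_graph:
  assumes "strict_linear_order_on {1..n} prec"
  shows "label (fusion_graph n prec) ` verts (fusion_graph n prec) = {1..Suc n}"
  using assms
proof (induction n arbitrary: prec)
  case 0
  then show ?case by simp
next
  case (Suc m)
  define s where "s = last (prec_list (Suc m) prec)"
  have s: "s \<in> {1..Suc m}"
    unfolding s_def by (rule last_prec_list_in[OF Suc.prems])
  define G where "G = fusion_graph m (inv_image prec (skip s))"
  have "label G ` verts G = {1..Suc m}"
    unfolding G_def using Suc.IH[OF strict_linear_order_on_inv_image_skip[OF Suc.prems s]] .
  moreover have "label (fuse s G) ` verts (fuse s G)
      = skip s ` label G ` verts G \<union> skip (Suc s) ` label G ` verts G"
    by (simp add: verts_fuse image_Un image_image)
  ultimately have "label (fuse s G) ` verts (fuse s G)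
      = skip s ` {1..Suc m} \<union> skip (Suc s) ` {1..Suc m}"
    by simp
  also have "\<dots> = ({1..Suc (Suc m)} - {s}) \<union> ({1..Suc (Suc m)} - {Suc s})"
    using s skip_image[of s "Suc m"] skip_image[of "Suc s" "Suc m"] by simp
  also have "\<dots> = {1..Suc (Suc m)}"
    by auto
  finally show ?case
    by (simp add: fusion_graph_Suc Let_def s_def[symmetric] G_def del: fusion_graph.simps)
qed

lemma label_fusion_graph:
  assumes "strict_linear_order_on {1..n} prec" and "v \<in> verts (fusion_graph n prec)"
  shows "label (fusion_graph n prec) v \<in> {1..Suc n}"
  using label_image_fusion_graph[OF assms(1)] assms(2) by blast

text \<open>The invariant behind the edges between the copies. Only vertices with label \<open>s\<close> before the
  fusion need an argument. In the plus copy such a vertex gets the label \<open>s + 1\<close>, and the new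
  coordinate \<open>s\<close> is its left neighbour, which is \<open>0\<close>. In the minus copy it keeps the label \<open>s\<close>, and
  the new coordinate \<open>s\<close> is \<open>c s\<close>, because the right neighbour is at its maximum.\<close>

lemma vertex_coords_at_label:
  assumes "strict_linear_order_on {1..n} prec" and "v \<in> verts (fusion_graph n prec)"
    and "k = label (fusion_graph n prec) v"
  shows "vertex_coords n prec c v (k - 1) = 0 \<and> vertex_coords n prec c v k = zero_ext n c k"
  using assms
proof (induction n arbitrary: prec c v k)
  case 0
  then show ?case by (simp add: zero_ext_def)
next
  case (Suc m)
  define s where "s = last (prec_list (Suc m) prec)"
  have s: "s \<in> {1..Suc m}"
    unfolding s_def by (rule last_prec_list_in[OF Suc.prems(1)])
  let ?prec = "inv_image prec (skip s)"
  define G where "G = fusion_graph m ?prec"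
  note ord = strict_linear_order_on_inv_image_skip[OF Suc.prems(1) s]
  have G: "fusion_graph (Suc m) prec = fuse s G"
    by (simp add: fusion_graph_Suc Let_def s_def G_def del: fusion_graph.simps)
  obtain b u where v: "v = b # u" "u \<in> verts G"
    using Suc.prems(2) unfolding G verts_fuse by blast
  define y where "y = vertex_coords m ?prec (c \<circ> skip s) u"
  define l where "l = label G u"
  have x: "vertex_coords (Suc m) prec c v
      = insert_coord s (if b then fibre_lower s y else fibre_upper m s c y) y"
    using v by (simp add: Let_def s_def y_def)
  have l: "1 \<le> l" "y (l - 1) = 0" "y l = zero_ext m (c \<circ> skip s) l"
    using Suc.IH[OF ord v(2)[unfolded G_def] refl] label_fusion_graph[OF ord v(2)[unfolded G_def]]
    unfolding y_def l_def G_def by (auto simp: comp_def)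
  have k: "k = (if b then skip s l else skip (Suc s) l)"
    using Suc.prems(3) unfolding G v(1) l_def by simp
  consider "l < s" | "l = s" | "l > s" by linarith
  then show ?case
  proof cases
    case 1
    then have "k = l" "l - 1 < s"
      using k by (simp_all add: skip_def)
    then show ?thesis
      using 1 l zero_ext_skip[OF s, of c l] unfolding x by (simp add: insert_coord_def skip_def)
  next
    case 2
    show ?thesis
    proof (cases b)
      case True
      then have "k = Suc s" using k 2 by (simp add: skip_def)
      then show ?thesis
        using True 2 l zero_ext_skip[OF s, of c l] unfolding x
        by (simp add: insert_coord_def fibre_lower_def skip_def)
    next
      case False
      then have "k = s" using k 2 by (simp add: skip_def)
      then show ?thesis
        using False 2 l s unfolding x
        by (cases s) (simp_all add: insert_coord_def fibre_upper_def zero_ext_def[of "Suc m"])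
    qed
  next
    case 3
    then have "k = Suc l"
      using k by (simp add: skip_def)
    then show ?thesis
      using 3 l zero_ext_skip[OF s, of c l] unfolding x by (simp add: insert_coord_def skip_def)
  qed
qed

text \<open>The coordinates of \<open>r k - r l\<close>, by telescoping.\<close>

definition label_step :: "nat \<Rightarrow> nat \<Rightarrow> nat \<Rightarrow> rat" where
  "label_step k l = (\<lambda>j. of_bool (k \<le> j) - of_bool (l \<le> j))"

lemma label_step_skip:
  assumes "1 \<le> s" and "1 \<le> k" and "1 \<le> l"
  shows "label_step (skip s k) (skip s l) j = label_step k l (if j < s then j else j - 1)"
  using assms by (auto simp: label_step_def skip_def of_bool_def)

text \<open>The new coordinate duplicates, up to a constant, the left neighbour on the plus copy and the right
  neighbour on the minus copy. The relabellings \<open>skip s\<close> and \<open>skip (Suc s)\<close> duplicate the same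
  coordinate of \<open>label_step\<close>, and the constant cancels.\<close>

lemma vertex_coords_edge:
  assumes "strict_linear_order_on {1..n} prec"
    and "v \<in> verts (fusion_graph n prec)" and "w \<in> verts (fusion_graph n prec)"
    and "({v, w}, e) \<in> edges (fusion_graph n prec)"
  shows "vertex_coords n prec c v - vertex_coords n prec c w
    = fscale (of_nat (c e)) (label_step (label (fusion_graph n prec) v) (label (fusion_graph n prec) w))"
  using assms
proof (induction n arbitrary: prec c v w e)
  case 0
  then show ?case by simp
next
  case (Suc m)
  define s where "s = last (prec_list (Suc m) prec)"
  have s: "s \<in> {1..Suc m}"
    unfolding s_def by (rule last_prec_list_in[OF Suc.prems(1)])
  let ?prec = "inv_image prec (skip s)"
  define G where "G = fusion_graph m ?prec"
  note ord = strict_linear_order_on_inv_image_skip[OF Suc.prems(1) s]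
  have G: "fusion_graph (Suc m) prec = fuse s G"
    by (simp add: fusion_graph_Suc Let_def s_def G_def del: fusion_graph.simps)
  let ?y = "vertex_coords m ?prec (c \<circ> skip s)"
  have x: "vertex_coords (Suc m) prec c (b # u)
      = insert_coord s (if b then fibre_lower s (?y u) else fibre_upper m s c (?y u)) (?y u)" for b u
    by (simp add: Let_def s_def)
  have rung_diff: "vertex_coords (Suc m) prec c (True # u) j - vertex_coords (Suc m) prec c (False # u) j
      = - of_nat (c s) * of_bool (j = s)" if "u \<in> verts G" "label G u = s" for u j
    using vertex_coords_at_label[OF ord that(1)[unfolded G_def] that(2)[unfolded G_def, symmetric],
        of "c \<circ> skip s"]
    unfolding x by (simp add: insert_coord_def fibre_lower_def fibre_upper_def)
  have rung_labels: "label (fuse s G) (True # u) = Suc s \<and> label (fuse s G) (False # u) = s"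
    if "label G u = s" for u
    using that by (simp add: skip_def)
  from Suc.prems(4)[unfolded G] show ?case
  proof (cases rule: edge_fuse_cases)
    case (copy b v' w' e')
    have vw: "v' \<in> verts G" "w' \<in> verts G"
      using Suc.prems(2,3) copy unfolding G by simp_all
    have pos: "1 \<le> label G v'" "1 \<le> label G w'"
      using label_fusion_graph[OF ord] vw unfolding G_def by force+
    have IH: "?y v' j - ?y w' j = of_nat (c e) * label_step (label G v') (label G w') j" for j
      using fun_cong[OF Suc.IH[OF ord vw[unfolded G_def] copy(4)[unfolded G_def], of "c \<circ> skip s"], of j]
      unfolding copy(3) G_def by (simp add: fscale_def comp_def)
    show ?thesis
    proof
      fix j
      show "(vertex_coords (Suc m) prec c v - vertex_coords (Suc m) prec c w) j
        = fscale (of_nat (c e)) (label_step (label (fusion_graph (Suc m) prec) v)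
            (label (fusion_graph (Suc m) prec) w)) j"
      proof (cases b)
        case True
        have "vertex_coords (Suc m) prec c v j - vertex_coords (Suc m) prec c w j
            = ?y v' (if j < s then j else j - 1) - ?y w' (if j < s then j else j - 1)"
          unfolding copy(1,2) x using True by (simp add: insert_coord_def fibre_lower_def)
        then show ?thesis
          using IH label_step_skip[of s "label G v'" "label G w'" j] s pos True
          unfolding G copy(1,2) by (simp add: fscale_def)
      next
        case False
        have "vertex_coords (Suc m) prec c v j - vertex_coords (Suc m) prec c w j
            = ?y v' (if j < Suc s then j else j - 1) - ?y w' (if j < Suc s then j else j - 1)"
          unfolding copy(1,2) x using False by (auto simp add: insert_coord_def fibre_upper_def)
        then show ?thesis
          using IH label_step_skip[of "Suc s" "label G v'" "label G w'" j] s pos False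
          unfolding G copy(1,2) by (simp add: fscale_def)
      qed
    qed
  next
    case (rung u)
    then show ?thesis
      using rung_diff[of u] rung_labels[of u] unfolding G
      by (auto simp: fun_eq_iff fscale_def label_step_def of_bool_def simp del: vertex_coords.simps label_fuse)
  next
    case (rung' u)
    have "vertex_coords (Suc m) prec c (False # u) j - vertex_coords (Suc m) prec c (True # u) j
        = of_nat (c s) * of_bool (j = s)" for j
      using rung_diff[of u j] rung' by simp
    then show ?thesis
      using rung' rung_labels[of u] unfolding G
      by (auto simp: fun_eq_iff fscale_def label_step_def of_bool_def simp del: vertex_coords.simps label_fuse)
  qed
qed

text \<open>Connectedness, in the form that a function which is constant along edges is constant. The two
  copies are joined by at least one edge because every label occurs in the smaller graph.\<close>

lemma fusion_graph_connected:
  assumes "strict_linear_order_on {1..n} prec"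
    and "\<And>v w e. v \<in> verts (fusion_graph n prec) \<Longrightarrow> w \<in> verts (fusion_graph n prec) \<Longrightarrow>
      ({v, w}, e) \<in> edges (fusion_graph n prec) \<Longrightarrow> f v = f w"
    and "v \<in> verts (fusion_graph n prec)" and "w \<in> verts (fusion_graph n prec)"
  shows "f v = f w"
  using assms
proof (induction n arbitrary: prec f v w)
  case 0
  then show ?case by simp
next
  case (Suc m)
  define s where "s = last (prec_list (Suc m) prec)"
  have s: "s \<in> {1..Suc m}"
    unfolding s_def by (rule last_prec_list_in[OF Suc.prems(1)])
  define G where "G = fusion_graph m (inv_image prec (skip s))"
  note ord = strict_linear_order_on_inv_image_skip[OF Suc.prems(1) s]
  have G: "fusion_graph (Suc m) prec = fuse s G"
    by (simp add: fusion_graph_Suc Let_def s_def G_def del: fusion_graph.simps)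
  note f = Suc.prems(2)[unfolded G]
  have copy: "f (b # v') = f (b # w')" if "v' \<in> verts G" "w' \<in> verts G" for b v' w'
  proof (rule Suc.IH[OF ord, folded G_def, where f = "\<lambda>v. f (b # v)"])
    show "f (b # v) = f (b # w)" if "v \<in> verts G" "w \<in> verts G" "({v, w}, e) \<in> edges G" for v w e
      using f[of "b # v" "b # w"] copy_edge_fuse[OF that(3), of b s] that(1,2) by simp
  qed (use that in simp_all)
  obtain u where u: "u \<in> verts G" "label G u = s"
    using label_image_fusion_graph[OF ord] s unfolding G_def by (metis imageE)
  have "f (True # u) = f (False # u)"
    using f rung_edge_fuse[OF u] u by simp
  then have "f (b # v') = f (True # u)" if "v' \<in> verts G" for b v'
    using copy[OF that u(1), of b] by (cases b) simp_all
  moreover obtain b v' b' w' where "v = b # v'" "w = b' # w'" "v' \<in> verts G" "w' \<in> verts G"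
    using Suc.prems(3,4) unfolding G verts_fuse by blast
  ultimately show ?case by metis
qed

section \<open>From coordinates to linear functions\<close>

lemma fun_of_coords_diff:
  "fun_of_coords r n (x - y) = fun_of_coords r n x - fun_of_coords r n y"
  unfolding fun_of_coords_def sum_subtractf[symmetric]
  by (intro sum.cong refl) (auto simp: fscale_def fun_eq_iff algebra_simps)

lemma fun_of_coords_fscale: "fun_of_coords r n (fscale a x) = fscale a (fun_of_coords r n x)"
proof -
  have "fscale a (f + g) = fscale a f + fscale a g" for f g :: "'a \<Rightarrow> rat"
    by (auto simp: fscale_def fun_eq_iff algebra_simps)
  moreover have "fscale a 0 = (0 :: 'a \<Rightarrow> rat)"
    by (auto simp: fscale_def fun_eq_iff)
  ultimately have "fscale a (sum g A) = (\<Sum>i\<in>A. fscale a (g i))" for g :: "nat \<Rightarrow> 'a \<Rightarrow> rat" and A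
    by (induction A rule: infinite_finite_induct) simp_all
  then show ?thesis
    unfolding fun_of_coords_def by (auto simp: fscale_def mult.assoc)
qed

lemma fun_of_coords_Suc:
  "fun_of_coords r (Suc n) x
    = fun_of_coords r n x + fscale (x (Suc n)) (r (Suc n) - r (Suc (Suc n)))"
  by (simp add: fun_of_coords_def)

lemma fun_of_coords_tail:
  assumes "k \<in> {1..Suc n}"
  shows "fun_of_coords r n (\<lambda>j. of_bool (k \<le> j)) = r k - r (Suc n)"
  using assms
proof (induction n)
  case 0
  then show ?case by (simp add: fun_of_coords_def)
next
  case (Suc n)
  show ?case
  proof (cases "k = Suc (Suc n)")
    case True
    then show ?thesis
      by (simp add: fun_of_coords_def fscale_def fun_eq_iff sum.neutral flip: zero_fun_def)
  next
    case False
    then have "fun_of_coords r n (\<lambda>j. of_bool (k \<le> j)) = r k - r (Suc n)"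
      using Suc.prems by (intro Suc.IH) simp
    then have "fun_of_coords r (Suc n) (\<lambda>j. of_bool (k \<le> j))
        = r k - r (Suc n) + fscale 1 (r (Suc n) - r (Suc (Suc n)))"
      using False Suc.prems by (simp add: fun_of_coords_Suc)
    then show ?thesis
      by (simp add: fscale_def fun_eq_iff)
  qed
qed

lemma fun_of_coords_label_step:
  assumes "k \<in> {1..Suc n}" and "l \<in> {1..Suc n}"
  shows "fun_of_coords r n (label_step k l) = r k - r l"
proof -
  have "label_step k l = (\<lambda>j. of_bool (k \<le> j)) - (\<lambda>j. of_bool (l \<le> j))"
    by (simp add: label_step_def fun_eq_iff)
  then show ?thesis
    by (simp add: fun_of_coords_diff fun_of_coords_tail[OF assms(1)] fun_of_coords_tail[OF assms(2)])
qed

lemma fun_of_coords_by_parts: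
  assumes "x 0 = 0"
  shows "fun_of_coords r n x
    = (\<Sum>k\<in>{1..n}. fscale (x k - x (k - 1)) (r k)) - fscale (x n) (r (Suc n))"
proof (induction n)
  case 0
  then show ?case by (simp add: fun_of_coords_def fscale_def assms fun_eq_iff)
next
  case (Suc n)
  show ?case
    unfolding fun_of_coords_Suc Suc by (simp add: fscale_def fun_eq_iff algebra_simps)
qed

lemma module_fscale: "module fscale"
  by unfold_locales (auto simp: fscale_def fun_eq_iff algebra_simps)

text \<open>After summation by parts the coefficients of the \<open>r k\<close> are the successive differences of the
  coordinates. These vanish by independence, so the coordinates are all equal to the one with index
  \<open>0\<close>.\<close>

lemma inj_on_fun_of_coords:
  assumes inj: "inj_on r {1..n + 1}" and indep: "\<not> module.dependent fscale (r ` {1..n + 1})"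
  shows "inj_on (fun_of_coords r n) (rat_space n)"
proof (rule inj_onI)
  fix x y assume xy: "x \<in> rat_space n" "y \<in> rat_space n"
    and eq: "fun_of_coords r n x = fun_of_coords r n y"
  define d where "d = x - y"
  have d: "d j = 0" if "j \<notin> {1..n}" for j
    using xy that by (simp add: d_def rat_space_def)
  define u where "u f = (let k = inv_into {1..n + 1} r f in d k - d (k - 1))" for f
  have u: "u (r k) = d k - d (k - 1)" if "k \<in> {1..n + 1}" for k
    unfolding u_def using inv_into_f_f[OF inj that] by simp
  have "0 = fun_of_coords r n d"
    using eq by (simp add: d_def fun_of_coords_diff)
  also have "\<dots> = (\<Sum>k\<in>{1..n + 1}. fscale (d k - d (k - 1)) (r k))"
    using d by (simp add: fun_of_coords_by_parts fscale_def fun_eq_iff)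
  also have "\<dots> = (\<Sum>k\<in>{1..n + 1}. fscale (u (r k)) (r k))"
    using u by (intro sum.cong refl) simp
  also have "\<dots> = (\<Sum>f\<in>r ` {1..n + 1}. fscale (u f) f)"
    by (subst sum.reindex[OF inj]) (simp only: comp_def)
  finally have "(\<Sum>f\<in>r ` {1..n + 1}. fscale (u f) f) = 0"
    by simp
  then have "u (r k) = 0" if "k \<in> {1..n + 1}" for k
    using module.independentD[OF module_fscale indep] that by blast
  then have step: "d k = d (k - 1)" if "k \<in> {1..n + 1}" for k
    using u that by force
  have "d k = 0" if "k \<le> n" for k
    using that
  proof (induction k)
    case 0
    then show ?case using d by simp
  next
    case (Suc k)
    then show ?case using step[of "Suc k"] by simp
  qed
  then have "d j = 0" for j
    using d by (cases "j \<le> n") auto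
  then show "x = y"
    by (auto simp: d_def fun_eq_iff)
qed

lemma linear_fun_of_coords:
  assumes "vector_space scale"
    and r: "\<And>i. i \<in> {1..n + 1} \<Longrightarrow> Vector_Spaces.linear scale (*) (r i)"
  shows "Vector_Spaces.linear scale (*) (fun_of_coords r n x)"
proof -
  have eq: "fun_of_coords r n x a = (\<Sum>i\<in>{1..n}. x i * (r i a - r (i + 1) a))" for a
  proof -
    have "(sum g A) a = (\<Sum>i\<in>A. g i a)" for g :: "nat \<Rightarrow> 'a \<Rightarrow> rat" and A
      by (induction A rule: infinite_finite_induct) simp_all
    then show ?thesis
      unfolding fun_of_coords_def by (simp add: fscale_def)
  qed
  have lin: "r i (a + b) = r i a + r i b" "r i (scale q a) = q * r i a"
    if "i \<in> {1..n + 1}" for i a b q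
    using r[OF that] unfolding Vector_Spaces.linear_iff by blast+
  have "fun_of_coords r n x (a + b) = fun_of_coords r n x a + fun_of_coords r n x b" for a b
    unfolding eq sum.distrib[symmetric]
    by (intro sum.cong refl) (simp add: lin algebra_simps)
  moreover have "fun_of_coords r n x (scale q a) = q * fun_of_coords r n x a" for q a
    unfolding eq sum_distrib_left
    by (intro sum.cong refl) (simp add: lin algebra_simps)
  moreover have "vector_space ((*) :: rat \<Rightarrow> rat \<Rightarrow> rat)"
    by unfold_locales (simp_all add: algebra_simps)
  ultimately show ?thesis
    unfolding Vector_Spaces.linear_iff using assms(1) by blast
qed

proposition z_family_eq:
  assumes ord: "strict_linear_order_on {1..n} prec"
    and vs: "vector_space scale"
    and r: "\<And>i. i \<in> {1..n + 1} \<Longrightarrow> Vector_Spaces.linear scale (*) (r i)"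
    and v: "v \<in> verts (fusion_graph n prec)"
  shows "z_family scale r n prec c v = fun_of_coords r n (vertex_coords n prec c v)"
proof -
  define G where "G = fusion_graph n prec"
  define z where "z = (\<lambda>v. if v \<in> verts G then fun_of_coords r n (vertex_coords n prec c v)
    else undefined)"
  define P where "P = (\<lambda>z. (\<forall>v. v \<notin> verts G \<longrightarrow> z v = undefined) \<and>
    (\<forall>v\<in>verts G. Vector_Spaces.linear scale (*) (z v)) \<and> z (base G) = 0 \<and>
    (\<forall>v\<in>verts G. \<forall>w\<in>verts G. \<forall>e. ({v, w}, e) \<in> edges G \<longrightarrow>
      z v - z w = fscale (of_nat (c e)) (r (label G v) - r (label G w))))"
  \<comment> \<open>Two solutions differ by a function that is constant along edges and \<open>0\<close> at the base.\<close>
  have base: "base G \<in> verts G"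
    unfolding G_def by (induction n arbitrary: prec)
      (simp_all add: fusion_graph_Suc Let_def del: fusion_graph.simps(2))
  have "z v - z w = fscale (of_nat (c e)) (r (label G v) - r (label G w))"
    if vw: "v \<in> verts G" "w \<in> verts G" "({v, w}, e) \<in> edges G" for v w e
  proof -
    have "z v - z w = fun_of_coords r n (vertex_coords n prec c v - vertex_coords n prec c w)"
      using vw by (simp add: z_def fun_of_coords_diff)
    also have "\<dots> = fscale (of_nat (c e)) (r (label G v) - r (label G w))"
      using vw label_fusion_graph[OF ord] unfolding G_def
      by (simp add: vertex_coords_edge[OF ord] fun_of_coords_fscale fun_of_coords_label_step)
    finally show ?thesis .
  qed
  moreover have "z (base G) = 0"
    using base vertex_coords_base[OF ord, of c]
    by (simp add: z_def G_def fun_of_coords_def fscale_def fun_eq_iff flip: zero_fun_def)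
  ultimately have "P z"
    unfolding P_def using linear_fun_of_coords[OF vs r] by (simp add: z_def)
  moreover have "z' = z" if "P z'" for z'
  proof
    fix v
    show "z' v = z v"
    proof (cases "v \<in> verts G")
      case True
      have "z' v - z v = z' w - z w"
        if "v \<in> verts G" "w \<in> verts G" "({v, w}, e) \<in> edges G" for v w e
      proof -
        have "z' v - z' w = z v - z w"
          using \<open>P z\<close> \<open>P z'\<close> that unfolding P_def by metis
        then show ?thesis
          by (simp add: algebra_simps)
      qed
      then have "z' v - z v = z' (base G) - z (base G)"
        using fusion_graph_connected[OF ord, where f = "\<lambda>v. z' v - z v"] True base
        unfolding G_def by blast
      then show ?thesis
        using \<open>P z\<close> \<open>P z'\<close> unfolding P_def by simp
    next
      case False
      then show ?thesis
        using \<open>P z\<close> \<open>P z'\<close> unfolding P_def by simp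
    qed
  qed
  ultimately have "(THE z. P z) = z"
    by (rule the_equality)
  then have "z_family scale r n prec c = z"
    unfolding z_family_def Let_def P_def G_def .
  then show ?thesis
    using v by (simp add: z_def G_def)
qed

theorem theorem1p4:
  fixes n :: nat
    and c :: "nat \<Rightarrow> nat"
    and prec :: "(nat \<times> nat) set"
    and scale :: "rat \<Rightarrow> 'v::ab_group_add \<Rightarrow> 'v"
    and r :: "nat \<Rightarrow> 'v \<Rightarrow> rat"
  assumes "n \<ge> 1"
    and "prec \<subseteq> {1..n} \<times> {1..n}"
    and "strict_linear_order_on {1..n} prec"
    and "\<And>i j. (i, j) \<in> prec \<Longrightarrow> c i \<le> c j"
    and "vector_space scale"
    and "vector_space.dim scale UNIV = n + 1"
    and "\<And>i. i \<in> {1..n + 1} \<Longrightarrow> Vector_Spaces.linear scale (*) (r i)"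
    and "inj_on r {1..n + 1}"
    and "\<not> module.dependent fscale (r ` {1..n + 1})"
  shows "rat_extreme_points (K_set n prec c) = Z_set scale r n prec c"
proof -
  let ?V = "verts (fusion_graph n prec)"
  have "inv_into (rat_space n) (fun_of_coords r n) (z_family scale r n prec c v)
      = vertex_coords n prec c v" if "v \<in> ?V" for v
    using z_family_eq[OF assms(3,5,7) that]
      inv_into_f_f[OF inj_on_fun_of_coords[OF assms(8,9)] vertex_coords_in_rat_space[OF assms(3)]]
    by simp
  then have "Z_set scale r n prec c = vertex_coords n prec c ` ?V"
    unfolding Z_set_def Z_functions_def image_image by (intro image_cong refl)
  moreover have "rat_extreme_points (K_set n prec c) = vertex_coords n prec c ` ?V"
    by (rule rat_extreme_points_K_set[OF assms(3)]) (rule assms(4))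
  ultimately show ?thesis by simp
qed

end
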